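(* Let $n$ be an even positive integer, let $\mathbf{x}\in\{0,1\}^n$ be any balanced word (i.e. of Hamming weight $n/2$), and let $\mathbf{c}=(c_1,\dots,c_n)\in\mathbb{R}^n$ be any cell-level vector. Let $v_b\in\mathbb{R}$ be a balancing threshold for $\mathbf{c}$ and let $v_o\in\mathbb{R}$ be an optimal threshold for $(\mathbf{x},\mathbf{c})$. Then $$N_e(v_b)\le 2\,N_e(v_o).$$
   Context: For a reading threshold $v\in\mathbb{R}$, the word read from $\mathbf{c}$ is $\mathbf{y}(v)=(y_1,\dots,y_n)\in\{0,1\}^n$, where $y_i=1$ if and only if $c_i\ge v$, and $y_i=0$ otherwise. Numbers of errors with respect to $\mathbf{x}=(x_1,\dots,x_n)$: $N^{(1\to0)}(v)=|\{i: x_i=1,\ y_i=0\}|$, $N^{(0\to1)}(v)=|\{i: x_i=0,\ y_i=1\}|$, and $N_e(v)=N^{(1\to 0)}(v)+N^{(0\to 1)}(v)$. A balancing threshold is a $v_b\in\mathbb{R}$ such that $\mathbf{y}(v_b)$ has Hamming weight exactly $n/2$. An optimal threshold is a $v_o\in\mathbb{R}$ that minimizes $N_e(v)$ over all $v\in\mathbb{R}$. *)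

theory Defs
  imports Complex_Main "HOL-Library.FuncSet"
begin

text \<open>Words and cell-level vectors of length \<open>n\<close> are functions on the index set \<open>{1..n}\<close>;
  values outside this set are irrelevant.\<close>

definition binary_word :: "nat \<Rightarrow> (nat \<Rightarrow> nat) \<Rightarrow> bool" where
  "binary_word n x \<longleftrightarrow> x \<in> {1..n} \<rightarrow> {0, 1}"

definition hamming_weight :: "nat \<Rightarrow> (nat \<Rightarrow> nat) \<Rightarrow> nat" where
  "hamming_weight n x = card {i \<in> {1..n}. x i \<noteq> 0}"

text \<open>Division on \<open>nat\<close> truncates; the notion is only meant for even \<open>n\<close>.\<close>

definition balanced_word :: "nat \<Rightarrow> (nat \<Rightarrow> nat) \<Rightarrow> bool" where
  "balanced_word n x \<longleftrightarrow> binary_word n x \<and> hamming_weight n x = n div 2"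

definition read_word :: "(nat \<Rightarrow> real) \<Rightarrow> real \<Rightarrow> nat \<Rightarrow> nat" where
  "read_word c v i = (if c i \<ge> v then 1 else 0)"

definition errors_1_to_0 :: "nat \<Rightarrow> (nat \<Rightarrow> nat) \<Rightarrow> (nat \<Rightarrow> real) \<Rightarrow> real \<Rightarrow> nat" where
  "errors_1_to_0 n x c v = card {i \<in> {1..n}. x i = 1 \<and> read_word c v i = 0}"

definition errors_0_to_1 :: "nat \<Rightarrow> (nat \<Rightarrow> nat) \<Rightarrow> (nat \<Rightarrow> real) \<Rightarrow> real \<Rightarrow> nat" where
  "errors_0_to_1 n x c v = card {i \<in> {1..n}. x i = 0 \<and> read_word c v i = 1}"

definition num_errors :: "nat \<Rightarrow> (nat \<Rightarrow> nat) \<Rightarrow> (nat \<Rightarrow> real) \<Rightarrow> real \<Rightarrow> nat" where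
  "num_errors n x c v = errors_1_to_0 n x c v + errors_0_to_1 n x c v"

definition balancing_threshold :: "nat \<Rightarrow> (nat \<Rightarrow> real) \<Rightarrow> real \<Rightarrow> bool" where
  "balancing_threshold n c v \<longleftrightarrow> hamming_weight n (read_word c v) = n div 2"

definition optimal_threshold :: "nat \<Rightarrow> (nat \<Rightarrow> nat) \<Rightarrow> (nat \<Rightarrow> real) \<Rightarrow> real \<Rightarrow> bool" where
  "optimal_threshold n x c v \<longleftrightarrow> (\<forall>w. num_errors n x c v \<le> num_errors n x c w)"

end

(* The balanced threshold makes equally many errors of both kinds, as the stored and the read word
   have equal weight. Moving the threshold up can only add 1-to-0 errors, moving it down can only
   add 0-to-1 errors; so at every threshold one of the two kinds is at least as frequent as at the
   balancing threshold, where it makes up half of all errors. *)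
theory Submission
  imports Defs
begin

lemma errors_1_to_0_mono:
  assumes "v \<le> w"
  shows "errors_1_to_0 n x c v \<le> errors_1_to_0 n x c w"
  unfolding errors_1_to_0_def read_word_def
  using assms by (intro card_mono) (auto split: if_splits)

lemma errors_0_to_1_antimono:
  assumes "v \<le> w"
  shows "errors_0_to_1 n x c w \<le> errors_0_to_1 n x c v"
  unfolding errors_0_to_1_def read_word_def
  using assms by (intro card_mono) (auto split: if_splits)

text \<open>Both sides count the union of the supports of \<open>x\<close> and of the read word:
  either support is completed to the union by the errors of one kind.\<close>

lemma hamming_weight_add_errors:
  assumes "binary_word n x"
  shows "hamming_weight n x + errors_0_to_1 n x c v
       = hamming_weight n (read_word c v) + errors_1_to_0 n x c v"
proof -
  define X where "X = {i \<in> {1..n}. x i \<noteq> 0}"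
  define Y where "Y = {i \<in> {1..n}. read_word c v i \<noteq> 0}"
  have fin: "finite X" "finite Y"
    by (simp_all add: X_def Y_def)
  have x01: "x i = 0 \<or> x i = 1" if "i \<in> {1..n}" for i
    using assms that by (auto simp: binary_word_def)
  \<comment> \<open>Membership in \<open>X\<close> only says \<open>x i \<noteq> 0\<close>; that
    \<open>x\<close> is binary turns this into \<open>x i = 1\<close>.\<close>
  have "{i \<in> {1..n}. x i = 1 \<and> read_word c v i = 0} = X - Y"
    using x01 by (fastforce simp: X_def Y_def)
  moreover have "{i \<in> {1..n}. x i = 0 \<and> read_word c v i = 1} = Y - X"
    by (auto simp: X_def Y_def read_word_def)
  moreover have "card X + card (Y - X) = card Y + card (X - Y)"
    using card_Un_disjoint[of X "Y - X"] card_Un_disjoint[of Y "X - Y"] fin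
    by (simp add: Un_commute)
  ultimately show ?thesis
    by (simp add: hamming_weight_def errors_1_to_0_def errors_0_to_1_def X_def Y_def)
qed

theorem theorem1:
  fixes n :: nat and x :: "nat \<Rightarrow> nat" and c :: "nat \<Rightarrow> real" and v_b v_o :: real
  assumes "even n" and "n > 0"
    and "balanced_word n x"
    and "balancing_threshold n c v_b"
    and "optimal_threshold n x c v_o"
  shows "num_errors n x c v_b \<le> 2 * num_errors n x c v_o"
proof -
  have "errors_0_to_1 n x c v_b = errors_1_to_0 n x c v_b"
    using hamming_weight_add_errors[of n x c v_b] assms(3,4)
    by (simp add: balanced_word_def balancing_threshold_def)
  \<comment> \<open>For \<open>v_b \<le> v_o\<close> the 1-to-0 errors at \<open>v_o\<close> already
    reach half of \<open>num_errors n x c v_b\<close>; otherwise the 0-to-1 errors do.\<close>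
  then show ?thesis
    using errors_1_to_0_mono[of v_b v_o n x c] errors_0_to_1_antimono[of v_o v_b n x c]
    unfolding num_errors_def by (cases "v_b \<le> v_o") simp_all
qed

end
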